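(* Let $D_0=(V,A)$ be a directed graph (parallel arcs allowed), let $k\ge 2$ be an integer, and let $F\subseteq A$ be such that the digraph obtained from $D_0$ by reversing the arcs of $F$ is $k$-arc-connected. Then there exist reorientations $D_1,\dots,D_\ell$ of $D_0$ such that for all $0\le i\le \ell-1$, $D_{i+1}$ is obtained from $D_i$ by reversing one arc of $F$, and $\lambda(D_0)\le\lambda(D_1)\le\dots\le\lambda(D_\ell)$ and $\lambda(D_\ell)\ge\lfloor\frac{k+3}{2}\rfloor$.
   Context: For a digraph $D=(V,A)$ and $X\subseteq V$, $d^-_A(X)$ denotes the number of arcs $uv\in A$ with $u\notin X$, $v\in X$. The arc-connectivity of $D$ is $\lambda(D)=\min\{d^-_A(X):\emptyset\ne X\subsetneq V\}$; $D$ is $k$-arc-connected if $\lambda(D)\ge k$. Reversing an arc $uv$ means replacing it by $vu$. A reorientation of $D$ is a digraph obtained from $D$ by reversing some of its arcs. *)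

theory Defs
  imports "Graph_Theory.Digraph" "HOL-Library.Extended_Nat"
begin

text \<open>
  Arcs have identities, so an arc keeps its name when it is reversed: the arc set is unchanged
  and only the two ends are exchanged.
\<close>

definition reverse_arcs :: "'b set \<Rightarrow> ('a, 'b) pre_digraph \<Rightarrow> ('a, 'b) pre_digraph" where
  "reverse_arcs R G =
     G\<lparr> tail := (\<lambda>e. if e \<in> R then head G e else tail G e),
        head := (\<lambda>e. if e \<in> R then tail G e else head G e) \<rparr>"

definition reorientation :: "('a, 'b) pre_digraph \<Rightarrow> ('a, 'b) pre_digraph \<Rightarrow> bool" where
  "reorientation G H \<longleftrightarrow> (\<exists>R \<subseteq> arcs G. H = reverse_arcs R G)"

definition set_in_degree :: "('a, 'b) pre_digraph \<Rightarrow> 'a set \<Rightarrow> nat" where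
  "set_in_degree G X = card {e \<in> arcs G. tail G e \<notin> X \<and> head G e \<in> X}"

text \<open>
  If there are at least two vertices, the infimum is the minimum over all nonempty proper
  vertex subsets. With at most one vertex there is no such subset, and the value is
  \<open>\<infinity>\<close>.
\<close>

definition arc_connectivity :: "('a, 'b) pre_digraph \<Rightarrow> enat" where
  "arc_connectivity G = (INF X \<in> {X. X \<noteq> {} \<and> X \<subset> verts G}. enat (set_in_degree G X))"

definition arc_connected :: "nat \<Rightarrow> ('a, 'b) pre_digraph \<Rightarrow> bool" where
  "arc_connected k G \<longleftrightarrow> enat k \<le> arc_connectivity G"

end

theory Submission
  imports Defs
begin

text \<open>
  Put \<open>c = \<lambda>(D)\<close> and suppose \<open>c \<le> (k + 1) / 2\<close> and \<open>c < k\<close>. Flipping an arc lowers the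
  arc-connectivity only if the arc enters a tight set, i.e. one of in-degree \<open>c\<close>. Suppose every arc
  of \<open>F\<close> does. Since reversing \<open>F\<close> makes the digraph \<open>k\<close>-arc-connected, the net number of
  \<open>F\<close>-arcs leaving a tight set is at least \<open>k - c \<ge> c - 1\<close>, and this net number is modular.
  Take a minimal non-singleton \<open>P\<close> that is tight or has a tight complement; by reversing all arcs,
  assume the latter, so that exactly \<open>c\<close> arcs leave \<open>P\<close>. By induction (contract \<open>P\<close>) some
  \<open>f \<in> F\<close> with an end outside \<open>P\<close> enters only tight sets that separate \<open>P\<close>; uncrossing and
  minimality show that \<open>f\<close> comes from outside \<open>P\<close> and enters a tight singleton \<open>{x} \<subseteq> P\<close>.
  The \<open>F\<close>-arcs leaving the union \<open>S\<close> of the tight singletons in \<open>P\<close> all leave \<open>P\<close>, and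
  there are at least \<open>card S * (k - c) + 1\<close> of them. Hence \<open>S = {x}\<close> and every arc leaving \<open>P\<close>
  starts at \<open>x\<close>. So the arcs leaving \<open>P - {x}\<close> all enter \<open>x\<close> and differ from \<open>f\<close>, which leaves
  at most \<open>c - 1\<close> of them, a contradiction.
\<close>

section \<open>In-degree counts: submodularity and modularity\<close>

text \<open>The end maps and the arc set are parameters, so that \<open>entering h t B X\<close>
  gives the arcs of \<open>B\<close> leaving \<open>X\<close>, and \<open>F\<close> can be counted
  apart from \<open>A\<close>.\<close>

definition entering :: "('b \<Rightarrow> 'a) \<Rightarrow> ('b \<Rightarrow> 'a) \<Rightarrow> 'b set \<Rightarrow> 'a set \<Rightarrow> 'b set" where
  "entering t h B X = {e \<in> B. t e \<notin> X \<and> h e \<in> X}"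

lemma entering_iff [simp]: "e \<in> entering t h B X \<longleftrightarrow> e \<in> B \<and> t e \<notin> X \<and> h e \<in> X"
  by (simp add: entering_def)

lemma finite_entering [simp]: "finite B \<Longrightarrow> finite (entering t h B X)"
  by (simp add: entering_def)

lemma card_entering_eq_sum:
  assumes "finite B"
  shows "int (card (entering t h B X)) = (\<Sum>e\<in>B. of_bool (t e \<notin> X \<and> h e \<in> X))"
proof -
  have "entering t h B X = B \<inter> {e. t e \<notin> X \<and> h e \<in> X}" by auto
  then show ?thesis by (simp only: sum_of_bool_eq[OF assms assms])
qed

lemma card_entering_submodular:
  assumes "finite B"
  shows "card (entering t h B (X \<inter> Y)) + card (entering t h B (X \<union> Y))
    \<le> card (entering t h B X) + card (entering t h B Y)"
proof -
  have "int (card (entering t h B (X \<inter> Y))) + int (card (entering t h B (X \<union> Y)))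
    \<le> int (card (entering t h B X)) + int (card (entering t h B Y))"
    unfolding card_entering_eq_sum[OF assms] sum.distrib[symmetric]
    by (intro sum_mono) auto
  then show ?thesis by linarith
qed

text \<open>An arc from \<open>X - Y\<close> to \<open>Y - X\<close> enters \<open>Y\<close>, but
  neither the intersection nor the union.\<close>

lemma card_entering_submodular_strict:
  assumes "finite B" "e \<in> B" "t e \<in> X - Y" "h e \<in> Y - X"
  shows "card (entering t h B (X \<inter> Y)) + card (entering t h B (X \<union> Y))
    < card (entering t h B X) + card (entering t h B Y)"
proof -
  have "int (card (entering t h B (X \<inter> Y))) + int (card (entering t h B (X \<union> Y)))
    < int (card (entering t h B X)) + int (card (entering t h B Y))"
    unfolding card_entering_eq_sum[OF assms(1)] sum.distrib[symmetric]
    using assms by (intro sum_strict_mono_ex1 bexI[of _ e]) auto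
  then show ?thesis by linarith
qed

text \<open>Arcs with both ends in \<open>X\<close> cancel, so each arc contributes a difference of
  indicators of its ends. This is linear in the indicator of \<open>X\<close>, hence
  modular.\<close>

lemma net_leaving_eq_sum:
  assumes "finite B"
  shows "int (card (entering h t B X)) - int (card (entering t h B X))
    = (\<Sum>e\<in>B. of_bool (t e \<in> X) - of_bool (h e \<in> X))"
  unfolding card_entering_eq_sum[OF assms] sum_subtractf[symmetric]
  by (intro sum.cong) auto

lemma net_leaving_modular:
  assumes "finite B" "finite X"
  shows "int (card (entering h t B X)) - int (card (entering t h B X))
    = (\<Sum>x\<in>X. int (card (entering h t B {x})) - int (card (entering t h B {x})))"
proof -
  have "(\<Sum>x\<in>X. of_bool (y \<in> {x}) :: int) = of_bool (y \<in> X)" for y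
    using assms(2) by (simp add: of_bool_def sum.delta)
  then show ?thesis
    unfolding net_leaving_eq_sum[OF assms(1)]
    by (subst sum.swap) (simp only: sum_subtractf)
qed

lemma eq_singleton_if_card_less_2:
  assumes "finite S" "\<not> 2 \<le> card S" "x \<in> S"
  shows "S = {x}"
proof -
  have "card S \<le> Suc 0" using assms(2) by simp
  then show ?thesis using assms(1,3) card_le_Suc0_iff_eq[OF assms(1)] by blast
qed

section \<open>Tight sets and uncrossing\<close>

text \<open>\<open>target\<close> says that reversing \<open>F\<close> makes all in-degrees at least
  \<open>k\<close>, written without subtraction. The number \<open>c\<close> is only a lower bound;
  a tight set is a witness that it is attained.\<close>

locale flippable =
  fixes V :: "'a set" and A F :: "'b set" and t h :: "'b \<Rightarrow> 'a" and c k :: nat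
  assumes finite_V: "finite V" and finite_A: "finite A" and F_sub: "F \<subseteq> A"
    and ends: "e \<in> A \<Longrightarrow> t e \<in> V \<and> h e \<in> V"
    and conn: "X \<noteq> {} \<Longrightarrow> X \<subset> V \<Longrightarrow> c \<le> card (entering t h A X)"
    and target: "X \<noteq> {} \<Longrightarrow> X \<subset> V \<Longrightarrow>
      k + card (entering t h F X) \<le> card (entering t h A X) + card (entering h t F X)"
    and c_less: "c < k" and c_le: "2 * c \<le> k + 1"
begin

definition tight :: "'a set \<Rightarrow> bool" where
  "tight X \<longleftrightarrow> X \<noteq> {} \<and> X \<subset> V \<and> card (entering t h A X) = c"

lemma finite_F: "finite F"
  using F_sub finite_A finite_subset by blast

lemma entering_compl:
  assumes "B \<subseteq> A" "X \<subseteq> V"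
  shows "entering t h B (V - X) = entering h t B X"
  using assms ends by (auto simp: entering_def)

lemma entering_compl':
  assumes "B \<subseteq> A" "X \<subseteq> V"
  shows "entering h t B (V - X) = entering t h B X"
  using assms ends by (auto simp: entering_def)

text \<open>Passing to complements exchanges entering and leaving arcs. This symmetry reduces the
  case of a tight \<open>P\<close> to that of a tight \<open>V - P\<close>.\<close>

lemma flippable_rev: "flippable V A F h t c k"
proof
  fix X assume X: "X \<noteq> {}" "X \<subset> V"
  then have X': "V - X \<noteq> {}" "V - X \<subset> V" by auto
  show "c \<le> card (entering h t A X)"
    using conn[OF X'] entering_compl[of A X] X by auto
  show "k + card (entering h t F X) \<le> card (entering h t A X) + card (entering t h F X)"
    using target[OF X'] entering_compl[of A X] entering_compl[of F X] entering_compl'[of F X] X F_sub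
    by auto
qed (use finite_V finite_A F_sub ends c_less c_le in auto)

lemma tight_rev: "flippable.tight V A h t c X \<longleftrightarrow> X \<subseteq> V \<and> tight (V - X)"
  unfolding flippable.tight_def[OF flippable_rev] tight_def
  using entering_compl[of A X] by auto

lemma tight_net:
  assumes "tight X"
  shows "k + card (entering t h F X) \<le> c + card (entering h t F X)"
  using target[of X] assms by (auto simp: tight_def)

text \<open>The net numbers of \<open>F\<close>-arcs leaving \<open>X\<close> and
  \<open>V - X\<close> are opposite, yet both would be at least \<open>k - c\<close>, which is
  positive.\<close>

lemma not_tight_compl:
  assumes "tight X"
  shows "\<not> tight (V - X)"
proof
  assume compl: "tight (V - X)"
  have X: "X \<subseteq> V" using assms by (auto simp: tight_def)
  show False
    using tight_net[OF assms] tight_net[OF compl] c_less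
    unfolding entering_compl[OF F_sub X] entering_compl'[OF F_sub X] by linarith
qed

text \<open>Intersection and union have in-degree at least \<open>c\<close> each and at most
  \<open>2 * c\<close> together, so submodularity holds with equality, which excludes arcs from
  \<open>X - Y\<close> to \<open>Y - X\<close>.\<close>

lemma tight_crossing:
  assumes "tight X" "tight Y" "X \<inter> Y \<noteq> {}" "X \<union> Y \<noteq> V"
  shows "tight (X \<inter> Y)" "tight (X \<union> Y)"
    and "\<And>e. e \<in> A \<Longrightarrow> t e \<in> X - Y \<Longrightarrow> h e \<in> Y - X \<Longrightarrow> False"
proof -
  have p: "X \<inter> Y \<subset> V" "X \<union> Y \<noteq> {}" "X \<union> Y \<subset> V"
    using assms by (auto simp: tight_def)
  have ge: "c \<le> card (entering t h A (X \<inter> Y))" "c \<le> card (entering t h A (X \<union> Y))"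
    by (fact conn[OF assms(3) p(1)] conn[OF p(2,3)])+
  have eq: "card (entering t h A X) = c" "card (entering t h A Y) = c"
    using assms by (auto simp: tight_def)
  show "tight (X \<inter> Y)" "tight (X \<union> Y)"
    using ge eq p assms(3) card_entering_submodular[OF finite_A, of t h X Y]
    by (auto simp: tight_def)
  show False if "e \<in> A" "t e \<in> X - Y" "h e \<in> Y - X" for e
    using card_entering_submodular_strict[of A e t X Y h, OF finite_A that] ge eq by linarith
qed

text \<open>The assumption on \<open>f\<close> is what the contraction of \<open>P\<close> provides by induction.\<close>

lemma no_minimal_out_tight:
  assumes cover: "\<And>f. f \<in> F \<Longrightarrow> \<exists>W. tight W \<and> t f \<notin> W \<and> h f \<in> W"
    and P: "P \<subset> V" "2 \<le> card P" "tight (V - P)"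
    and minP: "\<And>Q. Q \<subset> P \<Longrightarrow> 2 \<le> card Q \<Longrightarrow> \<not> tight Q \<and> \<not> tight (V - Q)"
    and f: "f \<in> F" "\<not> (t f \<in> P \<and> h f \<in> P)"
      "\<And>W. tight W \<Longrightarrow> P \<subseteq> W \<or> P \<inter> W = {} \<Longrightarrow> \<not> (t f \<notin> W \<and> h f \<in> W)"
  shows False
proof -
  have finP: "finite P" using P(1) finite_V finite_subset by blast
  have single: "\<exists>x. Q = {x}" if "Q \<subset> P" "Q \<noteq> {}" "tight Q \<or> tight (V - Q)" for Q
  proof -
    have "finite Q" using that finP finite_subset by blast
    moreover have "\<not> 2 \<le> card Q" using minP that by blast
    moreover obtain x where "x \<in> Q" using \<open>Q \<noteq> {}\<close> by blast
    ultimately have "Q = {x}" by (rule eq_singleton_if_card_less_2)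
    then show ?thesis ..
  qed
  have subV: "W \<subset> V" if "tight W" for W using that by (simp add: tight_def)
  have endsF: "t e \<in> V" "h e \<in> V" if "e \<in> F" for e using that ends F_sub by blast+
  obtain W where W: "tight W" "t f \<notin> W" "h f \<in> W" using cover f(1) by blast
  have sep: "\<not> P \<subseteq> W" "P \<inter> W \<noteq> {}" using f(3)[OF W(1)] W by blast+
  \<comment> \<open>Otherwise \<open>W\<close> crosses \<open>V - P\<close>. The tight set
    \<open>W \<inter> (V - P)\<close> misses \<open>P\<close>, so \<open>f\<close> cannot enter it
    and its head lies in \<open>P\<close>. Then \<open>f\<close> runs from
    \<open>(V - P) - W\<close> to \<open>W - (V - P)\<close>, which uncrossing forbids.\<close>
  have "W \<inter> (V - P) = {}"
  proof (rule ccontr)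
    assume ne: "W \<inter> (V - P) \<noteq> {}"
    have "W \<union> (V - P) \<noteq> V" using sep P(1) by blast
    note cr = tight_crossing[OF W(1) P(3) ne this]
    have cr3: False if "t f \<in> (V - P) - W" "h f \<in> W - (V - P)"
      using tight_crossing(3)[OF P(3) W(1), of f] ne \<open>W \<union> (V - P) \<noteq> V\<close> that f(1) F_sub by blast
    have "P \<inter> (W \<inter> (V - P)) = {}" by blast
    then have a: "h f \<in> P" using f(3)[OF cr(1)] W endsF f(1) by blast
    show False using cr3 a W f(1,2) endsF by blast
  qed
  then have "W \<subset> P" using sep subV[OF W(1)] by blast
  then obtain x where x: "W = {x}" using single[of W] W by blast
  then have tx: "tight {x}" "x \<in> P" "h f = x" "t f \<notin> P" using W \<open>W \<subset> P\<close> f(2) by auto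

  \<comment> \<open>Either the tight set entered by \<open>e\<close> lies in \<open>P\<close>, or
    its union with \<open>V - P\<close> is tight with complement inside \<open>P\<close>. Minimality
    of \<open>P\<close> makes the set, respectively this complement, a singleton.\<close>
  have inside: "tight {h e} \<or> tight (V - {t e})" if e: "e \<in> F" "t e \<in> P" "h e \<in> P" for e
  proof -
    obtain W where W: "tight W" "t e \<notin> W" "h e \<in> W" using cover e(1) by blast
    show ?thesis
    proof (cases "W \<inter> (V - P) = {}")
      case True
      then have "W \<subset> P" using subV[OF W(1)] W e by blast
      then show ?thesis using single[of W] W by auto
    next
      case False
      have "W \<union> (V - P) \<noteq> V" using W e P(1) by blast
      then have t: "tight (W \<union> (V - P))" using tight_crossing(2)[OF W(1) P(3) False] by blast
      have eq: "V - (P - W) = W \<union> (V - P)" using subV[OF W(1)] P(1) by blast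
      have "P - W \<subset> P" "P - W \<noteq> {}" using W e by blast+
      then obtain y where y: "P - W = {y}" using single[of "P - W"] t unfolding eq by blast
      have "t e \<in> P - W" using W e by blast
      then have "P - W = {t e}" unfolding y by blast
      then show ?thesis using t eq by simp
    qed
  qed

  define S where "S = {v \<in> P. tight {v}}"
  have finS: "finite S" and xS: "x \<in> S" using finP tx by (auto simp: S_def)
  have out_sub: "entering h t F S \<subseteq> entering h t A P"
  proof
    fix e assume e: "e \<in> entering h t F S"
    then have "t e \<in> P" "tight {t e}" "h e \<notin> S" "e \<in> F" by (auto simp: S_def)
    then have "h e \<notin> P" using inside[of e] not_tight_compl[of "{t e}"] by (auto simp: S_def)
    then show "e \<in> entering h t A P" using \<open>t e \<in> P\<close> \<open>e \<in> F\<close> F_sub by auto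
  qed
  have cP: "card (entering h t A P) = c"
    using P entering_compl[of A P] by (auto simp: tight_def)
  have "int (card S) * (int k - int c)
      \<le> (\<Sum>x\<in>S. int (card (entering h t F {x})) - int (card (entering t h F {x})))"
  proof (rule sum_bounded_below)
    fix v assume "v \<in> S"
    then show "int k - int c \<le> int (card (entering h t F {v})) - int (card (entering t h F {v}))"
      using tight_net[of "{v}"] by (simp add: S_def)
  qed
  also have "\<dots> = int (card (entering h t F S)) - int (card (entering t h F S))"
    by (rule net_leaving_modular[symmetric, OF finite_F finS])
  finally have net: "int (card S) * (int k - int c)
      \<le> int (card (entering h t F S)) - int (card (entering t h F S))" .
  have "f \<in> entering t h F S" using f(1) tx xS by (auto simp: S_def)
  then have f1: "card (entering t h F S) \<ge> 1"
    using finite_F card_gt_0_iff[of "entering t h F S"] by (auto simp: Suc_le_eq simp del: entering_iff)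
  have le: "card (entering h t F S) \<le> c"
    using card_mono[OF _ out_sub] finite_A cP by simp
  \<comment> \<open>Two tight singletons would give
    \<open>2 * (k - c) \<le> c - 1 \<le> k - c\<close>, against \<open>c < k\<close>. The
    \<open>- 1\<close> is due to \<open>f\<close> entering \<open>S\<close>.\<close>
  have "card S = 1"
  proof (rule ccontr)
    assume "card S \<noteq> 1"
    then have "card S \<ge> 2" using xS finS card_0_eq[of S] by (cases "card S") simp_all
    then have "2 * (int k - int c) \<le> int (card S) * (int k - int c)"
      using c_less by (intro mult_right_mono) auto
    also note net
    also have "int (card (entering h t F S)) - int (card (entering t h F S)) \<le> int c - 1"
      using f1 le by linarith
    finally have "2 * int k + 1 \<le> 3 * int c" by (simp add: right_diff_distrib)
    moreover have "2 * int c \<le> int k + 1" "int c + 1 \<le> int k" using c_le c_less by simp_all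
    ultimately show False by linarith
  qed
  then have S: "S = {x}" using xS by (auto simp: card_1_singleton_iff)
  \<comment> \<open>At least \<open>(k - c) + 1 \<ge> c\<close> arcs of \<open>F\<close> leave
    \<open>S\<close>, so they exhaust the \<open>c\<close> arcs leaving \<open>P\<close>.\<close>
  have "c \<le> card (entering h t F S)" using net f1 \<open>card S = 1\<close> c_le by simp
  then have eq: "entering h t F S = entering h t A P"
    using out_sub cP finite_A by (intro card_seteq) auto

  have sub: "entering h t A (P - {x}) \<subseteq> entering t h A {x} - {f}"
  proof
    fix e assume e: "e \<in> entering h t A (P - {x})"
    have "e \<notin> entering h t F S" using e S by simp
    then have "e \<notin> entering h t A P" unfolding eq .
    then show "e \<in> entering t h A {x} - {f}" using e tx by auto
  qed
  have "P - {x} \<noteq> {}"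
  proof
    assume "P - {x} = {}"
    then have "card P \<le> card {x}" by (intro card_mono) auto
    then show False using P(2) by simp
  qed
  then have ne: "V - (P - {x}) \<noteq> {}" "V - (P - {x}) \<subset> V" using P(1) by blast+
  have "P - {x} \<subseteq> V" using P(1) by blast
  from entering_compl[OF order_refl this]
  have "c \<le> card (entering h t A (P - {x}))" using conn[OF ne] by simp
  also have "\<dots> \<le> card (entering t h A {x} - {f})"
    using sub finite_A by (intro card_mono) auto
  also have "\<dots> < card (entering t h A {x})"
    using finite_A f(1) F_sub tx by (intro card_Diff1_less) auto
  also have "\<dots> = c" using tx by (simp add: tight_def)
  finally show False by simp
qed

text \<open>Contracting \<open>P\<close> to one vertex keeps exactly the tight sets that do not separate \<open>P\<close>.\<close>

lemma contraction:
  assumes P: "P \<subset> V" "2 \<le> card P" "tight P \<or> tight (V - P)"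
    and IH: "\<And>(V'::'a set) F' t' h'. card V' < card V \<Longrightarrow> flippable V' A F' t' h' c k \<Longrightarrow>
      \<exists>X. flippable.tight V' A t' h' c X \<Longrightarrow>
      \<exists>f\<in>F'. \<forall>X. flippable.tight V' A t' h' c X \<longrightarrow> \<not> (t' f \<notin> X \<and> h' f \<in> X)"
  shows "\<exists>f\<in>F. \<not> (t f \<in> P \<and> h f \<in> P) \<and>
    (\<forall>W. tight W \<longrightarrow> P \<subseteq> W \<or> P \<inter> W = {} \<longrightarrow> \<not> (t f \<notin> W \<and> h f \<in> W))"
proof -
  obtain p where p: "p \<in> P" using P(2) by fastforce
  define r where "r v = (if v \<in> P then p else v)" for v
  define V' where "V' = r ` V"
  \<comment> \<open>Arcs that become loops are dropped, so that the arc supplied by induction has an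
    end outside \<open>P\<close>. Loops enter no set, so the counts are unaffected.\<close>
  define F' where "F' = {f \<in> F. \<not> (t f \<in> P \<and> h f \<in> P)}"
  define U where "U X = {v \<in> V. r v \<in> X}" for X
  have A_eq: "entering (r \<circ> t) (r \<circ> h) A X = entering t h A (U X)" for X
    using ends by (auto simp: entering_def U_def)
  have F_eq: "entering (r \<circ> t) (r \<circ> h) F' X = entering t h F (U X)"
     "entering (r \<circ> h) (r \<circ> t) F' X = entering h t F (U X)" for X
    using ends F_sub by (auto simp: entering_def U_def F'_def r_def)
  have U_prop: "U X \<noteq> {}" "U X \<subset> V" if "X \<noteq> {}" "X \<subset> V'" for X
    using that by (auto simp: U_def V'_def)
  have V'_eq: "V' = (V - P) \<union> {p}" using P(1) p by (auto simp: V'_def r_def)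
  have "V' \<subset> V"
  proof -
    have "P \<noteq> {p}" using P(2) by auto
    then show ?thesis using V'_eq p P(1) by blast
  qed
  then have card: "card V' < card V" using finite_V by (rule psubset_card_mono[rotated])
  interpret C: flippable V' A F' "r \<circ> t" "r \<circ> h" c k
  proof
    fix X assume X: "X \<noteq> {}" "X \<subset> V'"
    show "c \<le> card (entering (r \<circ> t) (r \<circ> h) A X)"
      unfolding A_eq using U_prop[OF X] by (rule conn)
    show "k + card (entering (r \<circ> t) (r \<circ> h) F' X)
        \<le> card (entering (r \<circ> t) (r \<circ> h) A X) + card (entering (r \<circ> h) (r \<circ> t) F' X)"
      unfolding A_eq F_eq using U_prop[OF X] by (rule target)
  qed (use finite_V finite_A F_sub ends c_less c_le in \<open>auto simp: V'_def F'_def\<close>)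
  have lift: "C.tight (r ` W)" and mem: "\<And>v. v \<in> V \<Longrightarrow> r v \<in> r ` W \<longleftrightarrow> v \<in> W"
    if W: "tight W" "P \<subseteq> W \<or> P \<inter> W = {}" for W
  proof -
    show mem: "r v \<in> r ` W \<longleftrightarrow> v \<in> W" if "v \<in> V" for v
      using W p by (auto simp: r_def split: if_splits)
    have "W \<subset> V" "W \<noteq> {}" using W by (auto simp: tight_def)
    then have "U (r ` W) = W" using mem by (auto simp: U_def)
    moreover have "r ` W \<subset> V'"
      using \<open>W \<subset> V\<close> mem unfolding V'_def by blast
    ultimately show "C.tight (r ` W)"
      using W \<open>W \<noteq> {}\<close> unfolding C.tight_def A_eq tight_def by auto
  qed
  \<comment> \<open>Neither \<open>P\<close> nor \<open>V - P\<close> separates \<open>P\<close>, so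
    whichever is tight survives the contraction.\<close>
  have "\<exists>X. C.tight X" using P(3) lift[of P] lift[of "V - P"] by blast
  then obtain f where f: "f \<in> F'" "\<And>X. C.tight X \<Longrightarrow> \<not> ((r \<circ> t) f \<notin> X \<and> (r \<circ> h) f \<in> X)"
    using IH[OF card C.flippable_axioms] by blast
  have "t f \<in> V" "h f \<in> V" using f(1) F_sub ends by (auto simp: F'_def)
  then have "\<not> (t f \<notin> W \<and> h f \<in> W)" if "tight W" "P \<subseteq> W \<or> P \<inter> W = {}" for W
    using f(2)[OF lift[OF that]] mem[OF that] by simp
  then show ?thesis using f(1) by (auto simp: F'_def)
qed

end

section \<open>Induction on the number of vertices\<close>

text \<open>The tight set \<open>X\<close> ensures that \<open>F\<close> is nonempty: at least
  \<open>k - c\<close> arcs of \<open>F\<close> leave it.\<close>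

lemma exists_safe_flip:
  assumes "flippable V A F t h c k" "flippable.tight V A t h c X"
  shows "\<exists>f\<in>F. \<forall>X. flippable.tight V A t h c X \<longrightarrow> \<not> (t f \<notin> X \<and> h f \<in> X)"
  using assms
proof (induction "card V" arbitrary: V F t h X rule: less_induct)
  case (less V F t h X)
  interpret flippable V A F t h c k by fact
  interpret rev: flippable V A F h t c k by (rule flippable_rev)
  have X: "tight X" by fact
  show ?case
  proof (rule ccontr)
    assume "\<not> ?thesis"
    then have cover: "\<exists>W. tight W \<and> t f \<notin> W \<and> h f \<in> W" if "f \<in> F" for f using that by blast
    have IH: "\<exists>f\<in>F'. \<forall>X. flippable.tight V' A t' h' c X \<longrightarrow> \<not> (t' f \<notin> X \<and> h' f \<in> X)"
      if "card V' < card V" "flippable V' A F' t' h' c k"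
        "\<exists>X. flippable.tight V' A t' h' c X" for V' :: "'a set" and F' t' h'
      using less.hyps[OF that(1,2)] that(3) by blast
    define Q where "Q P \<longleftrightarrow> P \<subset> V \<and> 2 \<le> card P \<and> (tight P \<or> tight (V - P))" for P
    \<comment> \<open>Otherwise \<open>X\<close> and \<open>V - X\<close> are singletons. An arc of
      \<open>F\<close> leaving \<open>X\<close> then can enter no tight set but
      \<open>V - X\<close>, which is not tight.\<close>
    have "\<exists>P. Q P"
    proof (rule ccontr)
      assume none: "\<nexists>P. Q P"
      have XV: "X \<subset> V" "X \<noteq> {}" using X by (auto simp: tight_def)
      have "card (entering h t F X) \<noteq> 0" using tight_net[OF X] c_less by linarith
      then obtain e where e: "e \<in> entering h t F X"
        by (metis card.empty equals0I)
      have eq: "V - (V - X) = X" using XV by blast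
      have "\<not> Q (V - X)" using none by blast
      then have "\<not> 2 \<le> card (V - X)" using X XV eq by (auto simp: Q_def)
      moreover have "h e \<in> V - X" using e ends F_sub by auto
      ultimately have 1: "V - X = {h e}"
        using finite_V by (intro eq_singleton_if_card_less_2) auto
      have "finite X" using XV finite_V finite_subset by blast
      moreover have "\<not> 2 \<le> card X" using none X XV by (auto simp: Q_def)
      ultimately have 2: "X = {t e}"
        using e by (intro eq_singleton_if_card_less_2) auto
      obtain W where W: "tight W" "t e \<notin> W" "h e \<in> W" using cover[of e] e by auto
      then have "W \<subseteq> V" by (auto simp: tight_def)
      then have "W \<subseteq> V - X" unfolding 2 using W(2) by blast
      moreover have "V - X \<subseteq> W" unfolding 1 using W(3) by simp
      ultimately have "W = V - X" by (rule subset_antisym)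
      then have "tight (V - X)" using W(1) by (rule subst)
      then show False using not_tight_compl[OF X] by contradiction
    qed
    then obtain P0 where "Q P0" ..
    from ex_has_least_nat[of Q, OF this, of card]
    obtain P where QP: "Q P" and min: "\<And>R. Q R \<Longrightarrow> card P \<le> card R"
      by blast
    have P: "P \<subset> V" "2 \<le> card P" "tight P \<or> tight (V - P)" using QP by (auto simp: Q_def)
    have minP: "\<not> tight R \<and> \<not> tight (V - R)" if "R \<subset> P" "2 \<le> card R" for R
    proof -
      have "card R < card P" using that P(1) finite_V finite_subset psubset_card_mono by blast
      then show ?thesis using min[of R] that P(1) by (auto simp: Q_def)
    qed
    obtain f where f: "f \<in> F" "\<not> (t f \<in> P \<and> h f \<in> P)"
      "\<And>W. tight W \<Longrightarrow> P \<subseteq> W \<or> P \<inter> W = {} \<Longrightarrow> \<not> (t f \<notin> W \<and> h f \<in> W)"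
      using contraction[OF P IH] by blast
    show False
    proof (cases "tight (V - P)")
      case True
      show False by (rule no_minimal_out_tight[OF cover P(1,2) True minP f])
    next
      case False
      have rev_compl: "rev.tight (V - R) \<longleftrightarrow> tight R" if "R \<subseteq> V" for R
        unfolding tight_rev double_diff[OF that order_refl] by simp
      show False
      \<comment> \<open>Here \<open>P\<close> itself is tight, so its complement is tight once all
        arcs are reversed.\<close>
      proof (rule rev.no_minimal_out_tight[of P f])
        show "\<exists>W. rev.tight W \<and> h f \<notin> W \<and> t f \<in> W" if fF: "f \<in> F" for f
        proof -
          obtain W where W: "tight W" "t f \<notin> W" "h f \<in> W" using cover fF by blast
          then have "W \<subseteq> V" by (simp add: tight_def psubset_imp_subset)
          then have "rev.tight (V - W)" using rev_compl W(1) by blast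
          moreover have "t f \<in> V" using fF ends F_sub by blast
          ultimately show ?thesis using W(2,3) by blast
        qed
        show "rev.tight (V - P)" using rev_compl P(1,3) False by blast
        show "\<not> rev.tight R \<and> \<not> rev.tight (V - R)" if "R \<subset> P" "2 \<le> card R" for R
        proof -
          have "R \<subseteq> V" using that(1) P(1) by blast
          then show ?thesis using minP[OF that] rev_compl tight_rev by blast
        qed
        show "\<not> (h f \<notin> W \<and> t f \<in> W)" if "rev.tight W" "P \<subseteq> W \<or> P \<inter> W = {}" for W
        proof -
          have "tight (V - W)" using that(1) tight_rev by blast
          moreover have "P \<subseteq> V - W \<or> P \<inter> (V - W) = {}" using that(2) P(1) by blast
          ultimately have "\<not> (t f \<notin> V - W \<and> h f \<in> V - W)" by (rule f(3))
          moreover have "t f \<in> V" "h f \<in> V" using f(1) F_sub ends by blast+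
          ultimately show ?thesis by blast
        qed
      qed (use P(1,2) f(1,2) in blast)+
    qed
  qed
qed

section \<open>Transfer to digraphs\<close>

lemma reverse_arcs_simps [simp]:
  "verts (reverse_arcs R G) = verts G"
  "arcs (reverse_arcs R G) = arcs G"
  "tail (reverse_arcs R G) e = (if e \<in> R then head G e else tail G e)"
  "head (reverse_arcs R G) e = (if e \<in> R then tail G e else head G e)"
  by (simp_all add: reverse_arcs_def)

text \<open>Disjointness matters: an arc in both sets would be turned back.\<close>

lemma reverse_arcs_reverse_arcs:
  assumes "R \<inter> S = {}"
  shows "reverse_arcs R (reverse_arcs S G) = reverse_arcs (R \<union> S) G"
  using assms by (intro pre_digraph.equality ext) auto

lemma reverse_arcs_empty [simp]: "reverse_arcs {} G = G"
  by (intro pre_digraph.equality ext) auto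

lemma fin_digraph_reverse_arcs:
  assumes "fin_digraph G"
  shows "fin_digraph (reverse_arcs R G)"
proof -
  interpret fin_digraph G by fact
  show ?thesis by standard auto
qed

lemma set_in_degree_entering: "set_in_degree G X = card (entering (tail G) (head G) (arcs G) X)"
  by (simp add: set_in_degree_def entering_def)

lemma set_in_degree_reverse_arcs:
  assumes "finite (arcs G)" "R \<subseteq> arcs G"
  shows "set_in_degree (reverse_arcs R G) X + card (entering (tail G) (head G) R X)
    = set_in_degree G X + card (entering (head G) (tail G) R X)"
proof -
  have fR: "finite R" using assms finite_subset by blast
  let ?K = "entering (tail G) (head G) (arcs G - R) X"
  have 1: "entering (tail G) (head G) (arcs G) X = ?K \<union> entering (tail G) (head G) R X"
    using assms(2) by (auto simp: entering_def)
  have 2: "{e \<in> arcs G. tail (reverse_arcs R G) e \<notin> X \<and> head (reverse_arcs R G) e \<in> X}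
      = ?K \<union> entering (head G) (tail G) R X"
    using assms(2) by (auto simp: entering_def)
  have "card (?K \<union> entering (tail G) (head G) R X) = card ?K + card (entering (tail G) (head G) R X)"
    using assms(1) fR by (intro card_Un_disjoint) auto
  moreover have "card (?K \<union> entering (head G) (tail G) R X)
      = card ?K + card (entering (head G) (tail G) R X)"
    using assms(1) fR by (intro card_Un_disjoint) auto
  ultimately show ?thesis
    by (simp add: set_in_degree_entering[of G] 1) (simp add: set_in_degree_def 2[simplified])
qed

lemma arc_connectivity_ge_iff:
  "enat n \<le> arc_connectivity G \<longleftrightarrow> (\<forall>X. X \<noteq> {} \<and> X \<subset> verts G \<longrightarrow> n \<le> set_in_degree G X)"
  by (auto simp: arc_connectivity_def le_INF_iff)

lemma exists_monotone_flip:
  assumes "fin_digraph G" "2 \<le> k" "F \<subseteq> arcs G" "arc_connected k (reverse_arcs F G)"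
    and less: "\<not> enat ((k + 3) div 2) \<le> arc_connectivity G"
  shows "\<exists>a\<in>F. arc_connectivity G \<le> arc_connectivity (reverse_arcs {a} G)"
proof -
  interpret fin_digraph G by fact
  \<comment> \<open>The assumption \<open>less\<close> excludes the value infinity, so the infimum
    is attained and yields a tight set.\<close>
  obtain c where c: "arc_connectivity G = enat c" "c < (k + 3) div 2"
    using less by (cases "arc_connectivity G") auto
  have ge: "c \<le> set_in_degree G X" if "X \<noteq> {}" "X \<subset> verts G" for X
    using that arc_connectivity_ge_iff[of c G] c by simp
  have "\<not> enat (Suc c) \<le> arc_connectivity G" using c by simp
  then obtain X where X: "X \<noteq> {}" "X \<subset> verts G" "set_in_degree G X = c"
    unfolding arc_connectivity_ge_iff using ge by (metis le_antisym not_less_eq_eq)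
  interpret flippable "verts G" "arcs G" F "tail G" "head G" c k
  proof
    fix Y assume Y: "Y \<noteq> {}" "Y \<subset> verts G"
    show "c \<le> card (entering (tail G) (head G) (arcs G) Y)"
      using ge[OF Y] by (simp add: set_in_degree_entering)
    have "k \<le> set_in_degree (reverse_arcs F G) Y"
      using assms(4) Y by (simp add: arc_connected_def arc_connectivity_ge_iff)
    then show "k + card (entering (tail G) (head G) F Y)
        \<le> card (entering (tail G) (head G) (arcs G) Y) + card (entering (head G) (tail G) F Y)"
      using set_in_degree_reverse_arcs[OF finite_arcs assms(3), of Y]
      by (simp add: set_in_degree_entering[of G])
  \<comment> \<open>\<open>c < (k + 3) div 2\<close> amounts to \<open>2 * c \<le> k + 1\<close>,
    and \<open>k \<ge> 2\<close> then gives \<open>c < k\<close>.\<close>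
  qed (use assms c in auto)
  have "tight X" using X by (simp add: tight_def set_in_degree_entering)
  then obtain f where f: "f \<in> F" "\<And>X. tight X \<Longrightarrow> \<not> (tail G f \<notin> X \<and> head G f \<in> X)"
    using exists_safe_flip[OF flippable_axioms] by blast
  \<comment> \<open>Only sets entered by \<open>f\<close> lose in-degree. They lose at most one and,
    not being tight, start above \<open>c\<close>.\<close>
  have "c \<le> set_in_degree (reverse_arcs {f} G) Y" if Y: "Y \<noteq> {}" "Y \<subset> verts G" for Y
  proof -
    have d: "set_in_degree (reverse_arcs {f} G) Y + card (entering (tail G) (head G) {f} Y)
        \<ge> set_in_degree G Y"
      using set_in_degree_reverse_arcs[of G "{f}" Y] f(1) F_sub by auto
    show ?thesis
    proof (cases "tail G f \<notin> Y \<and> head G f \<in> Y")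
      case True
      then have "\<not> tight Y" using f by blast
      then have "c < set_in_degree G Y"
        using ge[OF Y] Y by (auto simp: tight_def set_in_degree_entering)
      moreover have "card (entering (tail G) (head G) {f} Y) \<le> card {f}"
        by (intro card_mono) auto
      ultimately show ?thesis using d by simp
    next
      case False
      then have "entering (tail G) (head G) {f} Y = {}" by auto
      then show ?thesis using d ge[OF Y] by simp
    qed
  qed
  then have "arc_connectivity G \<le> arc_connectivity (reverse_arcs {f} G)"
    unfolding c(1) arc_connectivity_ge_iff by simp
  then show ?thesis using f(1) by blast
qed

section \<open>Iterating safe flips\<close>

theorem theorem7:
  fixes D0 :: "('a, 'b) pre_digraph" and F :: "'b set" and k :: nat
  assumes "fin_digraph D0"
    and "k \<ge> 2"
    and "F \<subseteq> arcs D0"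
    and "arc_connected k (reverse_arcs F D0)"
  shows "\<exists>(l :: nat) (D :: nat \<Rightarrow> ('a, 'b) pre_digraph) (a :: nat \<Rightarrow> 'b).
           D 0 = D0 \<and>
           (\<forall>i \<in> {1..l}. reorientation D0 (D i)) \<and>
           inj_on a {..<l} \<and>
           (\<forall>i < l. a i \<in> F \<and> D (Suc i) = reverse_arcs {a i} (D i)) \<and>
           (\<forall>i < l. arc_connectivity (D i) \<le> arc_connectivity (D (Suc i))) \<and>
           arc_connectivity (D l) \<ge> enat ((k + 3) div 2)"
proof -
  define D where "D xs i = reverse_arcs (set (take i xs)) D0" for xs i
  define good where "good xs \<longleftrightarrow> distinct xs \<and> set xs \<subseteq> F \<and>
    (\<forall>i<length xs. arc_connectivity (D xs i) \<le> arc_connectivity (D xs (Suc i)))" for xs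
  have finF: "finite F"
    using assms(1,3) by (meson fin_digraph.finite_arcs finite_subset)
  have "good []" by (simp add: good_def)
  moreover have "\<forall>xs. good xs \<longrightarrow> length xs < Suc (card F)"
    using finF by (metis card_mono distinct_card good_def le_imp_less_Suc)
  \<comment> \<open>A longest good list exists because distinct arcs of \<open>F\<close> bound the
    length by \<open>card F\<close>. Its maximality replaces an induction on the flips.\<close>
  ultimately obtain xs where xs: "good xs" and max: "\<And>ys. good ys \<Longrightarrow> length ys \<le> length xs"
    using ex_has_greatest_nat[of good "[]" length "Suc (card F)"] by blast
  have dist: "distinct xs" and sub: "set xs \<subseteq> F" using xs by (auto simp: good_def)
  have final: "enat ((k + 3) div 2) \<le> arc_connectivity (D xs (length xs))"
  proof (rule ccontr)
    assume neg: "\<not> ?thesis"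
    let ?G = "reverse_arcs (set xs) D0"
    \<comment> \<open>Reversing the arcs of \<open>F\<close> not yet used still leads to the
      \<open>k\<close>-arc-connected digraph, so they supply a further flip, and no arc is flipped
      twice.\<close>
    have "reverse_arcs (F - set xs) ?G = reverse_arcs F D0"
      using sub by (subst reverse_arcs_reverse_arcs) (auto simp: Un_absorb2)
    then obtain b where b: "b \<in> F - set xs"
      "arc_connectivity ?G \<le> arc_connectivity (reverse_arcs {b} ?G)"
      using exists_monotone_flip[of ?G k "F - set xs"] neg assms fin_digraph_reverse_arcs[OF assms(1)]
      by (auto simp: D_def)
    have "good (xs @ [b])"
      using xs b by (auto simp: good_def D_def less_Suc_eq reverse_arcs_reverse_arcs)
    then show False using max by fastforce
  qed
  have step: "D xs (Suc i) = reverse_arcs {xs ! i} (D xs i)" if "i < length xs" for i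
  proof -
    have "xs ! i \<notin> set (take i xs)"
      using dist that by (auto simp: in_set_conv_nth nth_eq_iff_index_eq)
    then show ?thesis
      using that by (simp add: D_def take_Suc_conv_app_nth reverse_arcs_reverse_arcs)
  qed
  have "reorientation D0 (D xs i)" for i
    unfolding reorientation_def D_def using sub assms(3) set_take_subset[of i xs] by blast
  moreover have "inj_on ((!) xs) {..<length xs}"
    using dist by (simp add: inj_on_nth)
  moreover have "D xs 0 = D0" by (simp add: D_def)
  ultimately show ?thesis
    using final step xs sub
    by (intro exI[of _ "length xs"] exI[of _ "D xs"] exI[of _ "(!) xs"]) (auto simp: good_def)
qed

end
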